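(* Let $A=\{a_1,a_2,\dots\}$ with $0\le a_1\le a_2\le\cdots$ and $B=\{b_1,b_2,\dots\}$ with $0\le b_1\le b_2\le\cdots$ be multisets of nonnegative integers (listed with multiplicity, each integer occurring only finitely often), and let $\underline{\alpha}=(\alpha_1,\dots,\alpha_s)$, $\underline{\beta}=(\beta_1,\dots,\beta_t)$ be vectors of positive integers with $\alpha_1\le\cdots\le\alpha_s$, $\beta_1\le\cdots\le\beta_t$. Suppose $R_{A,\underline{\alpha}}(n)=R_{B,\underline{\beta}}(n)$ for every nonnegative integer $n$. Then: (1) For integers $u\ge -a_1$, $v\ge -b_1$, one has $R_{A+u,\underline{\alpha}}(n)=R_{B+v,\underline{\beta}}(n)$ for every nonnegative integer $n$ if and only if there exists $w\in\mathbb{Z}$ with \[u=w\frac{\beta_1+\cdots+\beta_t}{\gcd(\alpha_1+\cdots+\alpha_s,\ \beta_1+\cdots+\beta_t)},\qquad v=w\frac{\alpha_1+\cdots+\alpha_s}{\gcd(\alpha_1+\cdots+\alpha_s,\ \beta_1+\cdots+\beta_t)}.\] (2) $R_{A-a_1,\underline{\alpha}}(n)=R_{B-b_1,\underline{\beta}}(n)$ for every nonnegative integer $n$.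
   Context: For a multiset $A=\{a_1\le a_2\le\cdots\}$ of nonnegative integers (listed with multiplicity) and a vector $\underline{\alpha}=(\alpha_1,\dots,\alpha_s)$ of positive integers, $R_{A,\underline{\alpha}}(n)=|\{(j_1,\dots,j_s): j_i\in\mathbb{Z}^+,\ \sum_{i=1}^s\alpha_i a_{j_i}=n\}|$. For an integer $m$, $A+m$ is the multiset $\{a_i+m\}$ (same multiplicities). *)

theory Defs
  imports Complex_Main
begin

(* A multiset {a_1 \<le> a_2 \<le> ...} of nonnegative integers is represented by its nondecreasing
   enumeration with multiplicity, indexed from 0: a_j of the mathematics is "a (j - 1)", and the
   smallest element a_1 is "a 0".  Values are of type int so that translation by a negative
   integer does not truncate. *)

definition multiset_listing :: "(nat \<Rightarrow> int) \<Rightarrow> bool" where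
  "multiset_listing a \<longleftrightarrow> (\<forall>j. 0 \<le> a j) \<and> mono a \<and> (\<forall>k. finite {j. a j = k})"

(* Translation preserves the order, so this enumerates A + m in nondecreasing order. *)

definition translate :: "(nat \<Rightarrow> int) \<Rightarrow> int \<Rightarrow> nat \<Rightarrow> int" where
  "translate a m = (\<lambda>j. a j + m)"

(* The index tuples (j_1, ..., j_s) are lists of the same length as the weight vector.
   For a multiset_listing and positive weights the counted set is finite, so the convention
   that card is 0 on infinite sets plays no role. *)

definition rep_count :: "(nat \<Rightarrow> int) \<Rightarrow> nat list \<Rightarrow> nat \<Rightarrow> nat" where
  "rep_count a \<alpha> n =
     card {js :: nat list. length js = length \<alpha> \<and>
             (\<Sum>i<length \<alpha>. int (\<alpha> ! i) * a (js ! i)) = int n}"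

definition weight_vector :: "nat list \<Rightarrow> bool" where
  "weight_vector \<alpha> \<longleftrightarrow> \<alpha> \<noteq> [] \<and> (\<forall>x\<in>set \<alpha>. 0 < x) \<and> sorted \<alpha>"

end

(* Translating A by u shifts the counting function of A by u times the sum of the weights.
   The least n with a positive count is (sum of the weights) * (smallest element), so
   comparing least elements of the supports shows that two translates have equal counting
   functions exactly when the two shifts coincide. *)

theory Submission
  imports Defs
begin

text \<open>Translation moves the argument by an integer multiple of the total weight, which can
  carry a natural number below 0. With an integer argument, translation becomes an exact shift
  without truncation.\<close>

definition rep_count_int :: "(nat \<Rightarrow> int) \<Rightarrow> nat list \<Rightarrow> int \<Rightarrow> nat" where
  "rep_count_int a \<alpha> k =
     card {js :: nat list. length js = length \<alpha> \<and>
             (\<Sum>i<length \<alpha>. int (\<alpha> ! i) * a (js ! i)) = k}"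

lemma rep_count_eq_rep_count_int: "rep_count a \<alpha> n = rep_count_int a \<alpha> (int n)"
  by (simp add: rep_count_def rep_count_int_def)

lemma sum_int_nth: "(\<Sum>i<length \<alpha>. int (\<alpha> ! i)) = int (sum_list \<alpha>)"
  by (simp add: sum_list_sum_nth atLeast0LessThan)

lemma rep_count_int_translate:
  "rep_count_int (translate a u) \<alpha> k = rep_count_int a \<alpha> (k - int (sum_list \<alpha>) * u)"
proof -
  have "(\<Sum>i<length \<alpha>. int (\<alpha> ! i) * translate a u (js ! i))
          = (\<Sum>i<length \<alpha>. int (\<alpha> ! i) * a (js ! i)) + int (sum_list \<alpha>) * u" for js
    by (simp add: translate_def distrib_left sum.distrib flip: sum_int_nth sum_distrib_right)
  then show ?thesis
    by (simp add: rep_count_int_def eq_diff_eq)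
qed

lemma weighted_sum_ge:
  fixes a :: "nat \<Rightarrow> int"
  assumes "mono a"
  shows "int (sum_list \<alpha>) * a 0 \<le> (\<Sum>i<length \<alpha>. int (\<alpha> ! i) * a (js ! i))"
  unfolding sum_int_nth[symmetric] sum_distrib_right
  using assms by (intro sum_mono mult_left_mono) (simp_all add: monoD[of a 0])

text \<open>The excess over the minimum is a sum of nonnegative terms, so it vanishes only termwise,
  and positive weights then force every chosen entry to equal \<open>a 0\<close>.\<close>

lemma weighted_sum_eq_min_iff:
  fixes a :: "nat \<Rightarrow> int"
  assumes "mono a" and "\<forall>x\<in>set \<alpha>. 0 < x" and "length js = length \<alpha>"
  shows "(\<Sum>i<length \<alpha>. int (\<alpha> ! i) * a (js ! i)) = int (sum_list \<alpha>) * a 0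
           \<longleftrightarrow> set js \<subseteq> {j. a j = a 0}"
proof -
  have nn: "0 \<le> int (\<alpha> ! i) * (a (js ! i) - a 0)" for i
    using assms(1) by (simp add: monoD[of a 0])
  have "(\<Sum>i<length \<alpha>. int (\<alpha> ! i) * a (js ! i)) = int (sum_list \<alpha>) * a 0
          \<longleftrightarrow> (\<Sum>i<length \<alpha>. int (\<alpha> ! i) * (a (js ! i) - a 0)) = 0"
    by (simp add: right_diff_distrib sum_subtractf flip: sum_int_nth sum_distrib_right)
  also have "\<dots> \<longleftrightarrow> (\<forall>i<length \<alpha>. int (\<alpha> ! i) * (a (js ! i) - a 0) = 0)"
    using nn by (subst sum_nonneg_eq_0_iff) auto
  also have "\<dots> \<longleftrightarrow> (\<forall>i<length \<alpha>. a (js ! i) = a 0)"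
    using assms(2) by (force simp: all_set_conv_all_nth)
  also have "\<dots> \<longleftrightarrow> set js \<subseteq> {j. a j = a 0}"
    using assms(3) by (auto simp: subset_iff in_set_conv_nth)
  finally show ?thesis .
qed

lemma rep_count_int_below_min:
  assumes "mono a" and "k < int (sum_list \<alpha>) * a 0"
  shows "rep_count_int a \<alpha> k = 0"
proof -
  have "{js. length js = length \<alpha> \<and> (\<Sum>i<length \<alpha>. int (\<alpha> ! i) * a (js ! i)) = k} = {}"
    using weighted_sum_ge[OF assms(1), of \<alpha>] assms(2) by (auto simp flip: not_le)
  then show ?thesis
    unfolding rep_count_int_def by (simp only: card.empty)
qed

lemma rep_count_int_min_pos:
  assumes "multiset_listing a" and "\<forall>x\<in>set \<alpha>. 0 < x"
  shows "0 < rep_count_int a \<alpha> (int (sum_list \<alpha>) * a 0)"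
proof -
  have "mono a" and "finite {j. a j = a 0}"
    using assms(1) by (auto simp: multiset_listing_def)
  let ?S = "{js. set js \<subseteq> {j. a j = a 0} \<and> length js = length \<alpha>}"
  have "rep_count_int a \<alpha> (int (sum_list \<alpha>) * a 0) = card ?S"
    unfolding rep_count_int_def using weighted_sum_eq_min_iff[OF \<open>mono a\<close> assms(2)]
    by (intro arg_cong[where f = card]) auto
  \<comment> \<open>Finiteness is essential: \<open>card\<close> of an infinite set would be 0. It
    comes from the finite multiplicity of \<open>a 0\<close>.\<close>
  moreover have "finite ?S"
    using \<open>finite {j. a j = a 0}\<close> by (rule finite_lists_length_eq)
  moreover have "replicate (length \<alpha>) 0 \<in> ?S"
    by auto
  ultimately show ?thesis
    by (metis card_gt_0_iff empty_iff)
qed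

lemma rep_count_int_negative:
  assumes "multiset_listing a" and "k < 0"
  shows "rep_count_int a \<alpha> k = 0"
proof (rule rep_count_int_below_min)
  show "mono a"
    using assms(1) by (simp add: multiset_listing_def)
  have "0 \<le> int (sum_list \<alpha>) * a 0"
    using assms(1) by (simp add: multiset_listing_def)
  then show "k < int (sum_list \<alpha>) * a 0"
    using assms(2) by linarith
qed

text \<open>The hypothesis covers natural arguments only; at negative ones both counts vanish,
  because entries and weights are nonnegative.\<close>

lemma rep_count_int_eqI:
  assumes "multiset_listing a" and "multiset_listing b"
    and "\<forall>n. rep_count a \<alpha> n = rep_count b \<beta> n"
  shows "rep_count_int a \<alpha> k = rep_count_int b \<beta> k"
proof (cases "k < 0")
  case True
  then show ?thesis
    using assms(1,2) by (simp add: rep_count_int_negative)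
next
  case False
  then show ?thesis
    using assms(3)[rule_format, of "nat k"] by (simp add: rep_count_eq_rep_count_int)
qed

lemma support_min_eq:
  assumes "multiset_listing a" and "multiset_listing b"
    and "\<forall>x\<in>set \<alpha>. 0 < x" and "\<forall>x\<in>set \<beta>. 0 < x"
    and "\<forall>n. rep_count a \<alpha> n = rep_count b \<beta> n"
  shows "int (sum_list \<alpha>) * a 0 = int (sum_list \<beta>) * b 0"
proof -
  have "mono a" "mono b"
    using assms(1,2) by (auto simp: multiset_listing_def)
  then show ?thesis
    using rep_count_int_min_pos[OF assms(1,3)] rep_count_int_min_pos[OF assms(2,4)]
      rep_count_int_below_min[of a _ \<alpha>] rep_count_int_below_min[of b _ \<beta>]
      rep_count_int_eqI[OF assms(1,2,5)]
    \<comment> \<open>If the two minima differed, then at the smaller one the first count would be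
      positive and the other zero.\<close>
    by (metis less_irrefl linorder_neqE)
qed

text \<open>The bound on \<open>u\<close> keeps the entries nonnegative, so that
  \<open>support_min_eq\<close> applies to the translates as well.\<close>

lemma multiset_listing_translate:
  assumes "multiset_listing a" and "- a 0 \<le> u"
  shows "multiset_listing (translate a u)"
proof -
  have "a 0 \<le> a j" for j
    using assms(1) by (auto simp: multiset_listing_def mono_def)
  then have "0 \<le> a j + u" for j
    using assms(2) by (smt (verit))
  moreover have "{j. a j + u = k} = {j. a j = k - u}" for k
    by auto
  ultimately show ?thesis
    using assms(1) by (auto simp: multiset_listing_def translate_def mono_def)
qed

lemma rep_count_translate_eq_iff:
  assumes "multiset_listing a" and "multiset_listing b"
    and "\<forall>x\<in>set \<alpha>. 0 < x" and "\<forall>x\<in>set \<beta>. 0 < x"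
    and "\<forall>n. rep_count a \<alpha> n = rep_count b \<beta> n"
    and "- a 0 \<le> u" and "- b 0 \<le> v"
  shows "(\<forall>n. rep_count (translate a u) \<alpha> n = rep_count (translate b v) \<beta> n)
           \<longleftrightarrow> int (sum_list \<alpha>) * u = int (sum_list \<beta>) * v"
proof
  assume "\<forall>n. rep_count (translate a u) \<alpha> n = rep_count (translate b v) \<beta> n"
  then have "int (sum_list \<alpha>) * translate a u 0 = int (sum_list \<beta>) * translate b v 0"
    using assms by (intro support_min_eq multiset_listing_translate)
  \<comment> \<open>Subtract the equality of the minima before translation from the one after
    it.\<close>
  then show "int (sum_list \<alpha>) * u = int (sum_list \<beta>) * v"
    using support_min_eq[OF assms(1-5)] by (simp add: translate_def distrib_left)
next
  assume "int (sum_list \<alpha>) * u = int (sum_list \<beta>) * v"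
  then show "\<forall>n. rep_count (translate a u) \<alpha> n = rep_count (translate b v) \<beta> n"
    \<comment> \<open>The hypothesis is used at the shifted argument, which may be negative, hence
      in its integer form.\<close>
    using rep_count_int_eqI[OF assms(1,2,5)]
    by (simp add: rep_count_eq_rep_count_int rep_count_int_translate)
qed

text \<open>Dividing by the gcd leaves an equation with coprime coefficients \<open>s'\<close> and
  \<open>t'\<close>. Then \<open>s'\<close> divides \<open>v\<close>, and the quotient is the
  parameter \<open>w\<close>.\<close>

lemma mult_eq_mult_iff_gcd_multiple:
  fixes s t :: nat and u v :: int
  assumes "0 < s"
  shows "int s * u = int t * v \<longleftrightarrow>
    (\<exists>w :: int. rat_of_int u = rat_of_int w * (rat_of_nat t / rat_of_nat (gcd s t)) \<and>
                rat_of_int v = rat_of_int w * (rat_of_nat s / rat_of_nat (gcd s t)))"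
proof -
  define g where "g = gcd s t"
  have "g > 0"
    using assms by (simp add: g_def)
  obtain s' t' where st: "s = s' * g" "t = t' * g" and "coprime s' t'"
    using \<open>g > 0\<close> unfolding g_def by (metis gcd_coprime_exists less_irrefl)
  have "s' > 0"
    using assms st by (cases s') auto
  \<comment> \<open>Both fractions are in fact integers, so the rational conditions reduce to
    integer ones.\<close>
  have quot: "rat_of_nat s / rat_of_nat g = rat_of_int (int s')"
    "rat_of_nat t / rat_of_nat g = rat_of_int (int t')"
    using \<open>g > 0\<close> by (simp_all add: st)
  have "int s * u = int t * v \<longleftrightarrow> int s' * u = int t' * v"
    using \<open>g > 0\<close> by (simp add: st)
  also have "\<dots> \<longleftrightarrow> (\<exists>w. u = w * int t' \<and> v = w * int s')"
  proof
    assume eq: "int s' * u = int t' * v"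
    have "int s' dvd int t' * v"
      by (simp flip: eq)
    then have "int s' dvd v"
      using \<open>coprime s' t'\<close> by (simp add: coprime_dvd_mult_right_iff)
    then obtain w where "v = int s' * w" ..
    then show "\<exists>w. u = w * int t' \<and> v = w * int s'"
      \<comment> \<open>Substituting \<open>v = int s' * w\<close> and cancelling the positive
        \<open>s'\<close> gives the formula for \<open>u\<close>.\<close>
      using eq \<open>s' > 0\<close> by (intro exI[of _ w]) simp
  qed auto
  finally show ?thesis
    unfolding g_def[symmetric] quot by (simp only: of_int_mult[symmetric] of_int_eq_iff)
qed

theorem theorem1p4:
  fixes a b :: "nat \<Rightarrow> int" and \<alpha> \<beta> :: "nat list"
  assumes "multiset_listing a" and "multiset_listing b"
    and "weight_vector \<alpha>" and "weight_vector \<beta>"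
    and "\<forall>n. rep_count a \<alpha> n = rep_count b \<beta> n"
  shows "(\<forall>u v :: int. u \<ge> - a 0 \<and> v \<ge> - b 0 \<longrightarrow>
            ((\<forall>n. rep_count (translate a u) \<alpha> n = rep_count (translate b v) \<beta> n) \<longleftrightarrow>
             (\<exists>w :: int.
                rat_of_int u = rat_of_int w *
                  (rat_of_nat (sum_list \<beta>) / rat_of_nat (gcd (sum_list \<alpha>) (sum_list \<beta>))) \<and>
                rat_of_int v = rat_of_int w *
                  (rat_of_nat (sum_list \<alpha>) / rat_of_nat (gcd (sum_list \<alpha>) (sum_list \<beta>))))))
       \<and> (\<forall>n. rep_count (translate a (- a 0)) \<alpha> n = rep_count (translate b (- b 0)) \<beta> n)"
proof -
  have pos: "\<forall>x\<in>set \<alpha>. 0 < x" "\<forall>x\<in>set \<beta>. 0 < x" and "0 < sum_list \<alpha>"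
    using assms(3,4) by (cases \<alpha>; auto simp: weight_vector_def)+
  note iff = rep_count_translate_eq_iff[OF assms(1,2) pos assms(5)]
  \<comment> \<open>For these shifts the criterion is the equality of the two minima with both sides
    negated.\<close>
  have "\<forall>n. rep_count (translate a (- a 0)) \<alpha> n = rep_count (translate b (- b 0)) \<beta> n"
    using support_min_eq[OF assms(1,2) pos assms(5)] by (simp add: iff)
  then show ?thesis
    \<comment> \<open>The rewrite \<open>iff\<close> is conditional on the bounds for
      \<open>u\<close> and \<open>v\<close>; \<open>imp_cong\<close> supplies them from the
      antecedent.\<close>
    by (simp only: iff mult_eq_mult_iff_gcd_multiple[OF \<open>0 < sum_list \<alpha>\<close>] cong: imp_cong)
       simp
qed

end
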